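(* Consider SPARKLE-ED-GT, i.e. SPARKLE using ED for $y$ and $z$ ($A_s=W_s$, $B_s=(I-W_s)^{1/2}$, $C_s=W_s$ for $s\in\{y,z\}$) and GT for $x$ ($A_x=W_x^2$, $B_x=I-W_x$, $C_x=W_x^2$), with $W_x=W_y=W_z$ and $\rho=\rho(W_x)$. Then (for a suitable choice of the factorizations defining $\mathbf O_s,\mathbf\Gamma_s$) $$\delta_x=\delta_y=\delta_z=\mathcal O\big((1-\rho)^{-2}\big),\qquad\hat\delta_x=\hat\delta_y=\hat\delta_z=\mathcal O\big((1-\rho)^{-2}\big)$$ (each of the six quantities is of the stated order), which implies that the transient iteration complexity $\max\{n^2\delta_x,n^3\delta_y,n^3\delta_z,n\hat\delta_x,n\hat\delta_y,n\hat\delta_z\}$ simplifies to order $n^3/(1-\rho)^2$.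
   Context: **Problem.** Agents $i=1,\dots,n$ hold $f_i(x,y)=\mathbb E_{\phi\sim\mathcal D_{f_i}}[F_i(x,y;\phi)]$ and $g_i(x,y)=\mathbb E_{\xi\sim\mathcal D_{g_i}}[G_i(x,y;\xi)]$ on $\mathbb R^p\times\mathbb R^q$. Put $f=\frac1n\sum_if_i$, $g=\frac1n\sum_ig_i$, $y^\star(x)=\arg\min_yg(x,y)$, $\Phi(x)=f(x,y^\star(x))$; indices $1,2$ on $\nabla$ denote derivatives in the first/second argument. $\|\cdot\|$ is the Euclidean/spectral norm. **Assumptions.** (1) For every $i$: $\nabla f_i,\nabla g_i,\nabla^2g_i$ are Lipschitz with constants $L_{f,1},L_{g,1},L_{g,2}$; $\|\nabla_2f_i(x,y^\star(x))\|\le L_{f,0}$ for all $x$; $g_i(x,\cdot)$ is $\mu_g$-strongly convex for every $x$. (2) For $s\in\{x,y,z\}$, $W_s\in\mathbb R^{n\times n}$ is nonnegative, symmetric, doubly stochastic, with eigenvalues $1=\lambda_1>\lambda_2\ge\dots\ge\lambda_n$ and $\rho(W_s)=\max\{|\lambda_2|,|\lambda_n|\}<1$; moreover (required for ED) $W_s$ is positive definite with smallest eigenvalue bounded below by a positive constant $\underline\rho$, treated as an absolute constant (otherwise $W_s$ is replaced by $tI+(1-t)W_s$ for a constant $t\in(0,1)$). (3) The stochastic estimates $\nabla F_i,\nabla G_i,\nabla^2G_i$ are unbiased for $\nabla f_i,\nabla g_i,\nabla^2g_i$ with variances bounded by $\sigma_{f,1}^2,\sigma_{g,1}^2,\sigma_{g,2}^2$.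 **SPARKLE algorithm.** Bold letters stack agents: $\mathbf x^k=\mathrm{col}\{x_1^k,\dots,x_n^k\}$, and $\mathbf A_s=A_s\otimes I$, $\mathbf B_s=B_s\otimes I$, $\mathbf C_s=C_s\otimes I$; $\bar x^k=\frac1n\sum_ix_i^k$. Start from $\mathbf x^0=\mathbf y^0=\mathbf z^0=\mathbf r^0=\mathbf 0$, $\mathbf d_x^0=\mathbf d_y^0=\mathbf d_z^0=\mathbf 0$; for $k=0,1,\dots$ $\mathbf y^{k+1}=\mathbf C_y\mathbf y^k-\beta\mathbf A_y\mathbf v^k-\mathbf B_y\mathbf d_y^k$, $\mathbf d_y^{k+1}=\mathbf d_y^k+\mathbf B_y\mathbf y^{k+1}$; $\mathbf z^{k+1}=\mathbf C_z\mathbf z^k-\gamma\mathbf A_z\mathbf p^k-\mathbf B_z\mathbf d_z^k$, $\mathbf d_z^{k+1}=\mathbf d_z^k+\mathbf B_z\mathbf z^{k+1}$; $\mathbf r^{k+1}=(1-\theta)\mathbf r^k+\theta\mathbf u^k$; $\mathbf x^{k+1}=\mathbf C_x\mathbf x^k-\alpha\mathbf A_x\mathbf r^{k+1}-\mathbf B_x\mathbf d_x^k$, $\mathbf d_x^{k+1}=\mathbf d_x^k+\mathbf B_x\mathbf x^{k+1}$. Here $v_i^k=\nabla_2G_i(x_i^k,y_i^k;\cdot)$; $p_i^k=H_i^kz_i^k-b_i^k$ with $H_i^k=\nabla^2_{22}G_i(x_i^k,y_i^{k+1};\cdot)$, $b_i^k=\nabla_2F_i(x_i^k,y_i^{k+1};\cdot)$;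 $u_i^k=l_i^k-J_i^kz_i^{k+1}$ with $l_i^k=\nabla_1F_i(x_i^k,y_i^{k+1};\cdot)$, $J_i^k=\nabla^2_{12}G_i(x_i^k,y_i^{k+1};\cdot)$. The samples are independent across agents and, conditionally on the history available before each of $\mathbf v^k,\mathbf p^k,\mathbf u^k$ is formed, the estimates are unbiased with variances bounded by $\sigma_{f,1}^2$ (for $\nabla F_i$), $\sigma_{g,1}^2$ (for $\nabla G_i$) and $\sigma_{g,2}^2$ (for $\nabla^2G_i$). **Matrix quantities.** Write $W_s=U_s\,\mathrm{diag}(1,\Lambda_s)U_s^\top$, $U_s=[\frac1{\sqrt n}\mathbf 1_n,\hat U_s]$ orthogonal. Then $A_s=U_s\mathrm{diag}(1,\Lambda_{sa})U_s^\top$, $B_s^2=U_s\mathrm{diag}(0,\Lambda_{sb}^2)U_s^\top$, $C_s=U_s\mathrm{diag}(1,\Lambda_{sc})U_s^\top$ with diagonal $\Lambda_{sa},\Lambda_{sb},\Lambda_{sc}$ of size $n-1$ and $\Lambda_{sb}$ positive definite; bold versions are $\otimes I$. Factor $\mathbf M_s=\begin{bmatrix}\mathbf\Lambda_{sc}-\mathbf\Lambda_{sb}^2&-\mathbf\Lambda_{sb}\\\mathbf\Lambda_{sb}&\mathbf I\end{bmatrix}=\mathbf O_s\mathbf\Gamma_s\mathbf O_s^{-1}$ with $\mathbf O_s$ invertible and $\|\mathbf\Gamma_s\|<1$ (same factorization for equal data). For $s\in\{y,z\}$, $$\delta_s=\Big(\tfrac{\|\mathbf O_s\|^2\|\mathbf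 O_s^{-1}\|^2}{1-\|\mathbf\Gamma_s\|}\Big)^2\|\mathbf\Lambda_{sa}\|^2,\quad \hat\delta_s=\Big(\tfrac{\|\mathbf O_s\|\|\mathbf O_s^{-1}\|\|\mathbf\Lambda_{sb}^{-1}\|}{1-\|\mathbf\Gamma_s\|}\Big)^{4/3},$$ $$\delta_x=\Big(\tfrac{\|\mathbf O_x\|\|\mathbf O_x^{-1}\|}{1-\|\mathbf\Gamma_x\|}\|\mathbf\Lambda_{xa}\|\Big)^2,\quad \hat\delta_x=\Big(\tfrac{\|\mathbf O_x\|^2\|\mathbf O_x^{-1}\|^2\|\mathbf\Lambda_{xb}^{-1}\|^2}{1-\|\mathbf\Gamma_x\|}\Big)^{2/3}+\tfrac{\|\mathbf O_x\|\|\mathbf O_x^{-1}\|\|\mathbf\Lambda_{xb}^{-1}\|}{1-\|\mathbf\Gamma_x\|}.$$ **Transient iteration complexity.** The number of iterations $K$ (up to constants) after which, for suitable constant $\alpha,\beta,\gamma,\theta$, the guaranteed bound on $\frac1{K+1}\sum_{k\le K}\mathbb E\|\nabla\Phi(\bar x^k)\|^2$ is of the linear-speedup order $1/\sqrt{nK}$; dependence on the initialization, smoothness constants, $\kappa=\max\{L_{f,0},L_{f,1},L_{g,1},L_{g,2}\}/\mu_g$ and noise levels is suppressed. For SPARKLE it is of order $\max\{n^2\delta_x,n^3\delta_y,n^3\delta_z,n\hat\delta_x,n\hat\delta_y,n\hat\delta_z\}$. *)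

theory Defs
  imports
    "Jordan_Normal_Form.Char_Poly"
    "Jordan_Normal_Form.Gauss_Jordan_Elimination"
    Complex_Main
begin

(* Matrices of the library type mat are used because the number n of agents varies inside the
   statement: the constants of the O-bounds must not depend on n (nor on p and q). *)

definition vnorm :: "real vec \<Rightarrow> real" where
  "vnorm v = sqrt (v \<bullet> v)"

definition spectral_norm :: "real mat \<Rightarrow> real" where
  "spectral_norm A = (SUP v \<in> {v \<in> carrier_vec (dim_col A). vnorm v \<le> 1}. vnorm (A *\<^sub>v v))"

(* Only used for invertible matrices. *)
abbreviation inv_mat :: "real mat \<Rightarrow> real mat" where
  "inv_mat A \<equiv> the (mat_inverse A)"

definition symmetric_mat :: "real mat \<Rightarrow> bool" where
  "symmetric_mat A \<longleftrightarrow> transpose_mat A = A"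

definition pos_semidef :: "real mat \<Rightarrow> bool" where
  "pos_semidef A \<longleftrightarrow> square_mat A \<and> symmetric_mat A \<and>
     (\<forall>v \<in> carrier_vec (dim_row A). 0 \<le> v \<bullet> (A *\<^sub>v v))"

definition pos_def :: "real mat \<Rightarrow> bool" where
  "pos_def A \<longleftrightarrow> square_mat A \<and> symmetric_mat A \<and>
     (\<forall>v \<in> carrier_vec (dim_row A). v \<noteq> 0\<^sub>v (dim_row A) \<longrightarrow> 0 < v \<bullet> (A *\<^sub>v v))"

definition kronecker :: "real mat \<Rightarrow> real mat \<Rightarrow> real mat" where
  "kronecker A B = mat (dim_row A * dim_row B) (dim_col A * dim_col B)
     (\<lambda>(i, j). A $$ (i div dim_row B, j div dim_col B) * B $$ (i mod dim_row B, j mod dim_col B))"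

(* The real eigenvalues with algebraic multiplicity, in decreasing order; for a symmetric
   n x n matrix the list has length n. The list is indexed from 0: lambda_2 is entry 1. *)
definition eigvals_desc :: "real mat \<Rightarrow> real list" where
  "eigvals_desc W = rev (sorted_list_of_multiset (proots (char_poly W)))"

definition mixing_rho :: "real mat \<Rightarrow> real" where
  "mixing_rho W = max \<bar>eigvals_desc W ! 1\<bar> \<bar>last (eigvals_desc W)\<bar>"

(* rho_min is the absolute constant bounding the smallest eigenvalue from below. *)
definition mixing_matrix :: "real \<Rightarrow> nat \<Rightarrow> real mat \<Rightarrow> bool" where
  "mixing_matrix rho_min n W \<longleftrightarrow>
     W \<in> carrier_mat n n \<and> symmetric_mat W \<and>
     (\<forall>i<n. \<forall>j<n. 0 \<le> W $$ (i, j)) \<and>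
     (\<forall>i<n. (\<Sum>j<n. W $$ (i, j)) = 1) \<and> (\<forall>j<n. (\<Sum>i<n. W $$ (i, j)) = 1) \<and>
     eigvals_desc W ! 0 = 1 \<and> eigvals_desc W ! 1 < 1 \<and> mixing_rho W < 1 \<and>
     pos_def W \<and> rho_min \<le> last (eigvals_desc W)"

(* The data attached to one of the variables x, y, z: W_s, A_s, B_s, C_s, U_s and
   Lambda_s, Lambda_sa, Lambda_sb, Lambda_sc. *)
record mixing_data =
  mW :: "real mat"
  mA :: "real mat"
  mB :: "real mat"
  mC :: "real mat"
  mU :: "real mat"
  Lam :: "real mat"
  Lam_a :: "real mat"
  Lam_b :: "real mat"
  Lam_c :: "real mat"

(* diag(c, L) *)
definition diag_cons :: "real \<Rightarrow> real mat \<Rightarrow> real mat" where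
  "diag_cons c L = diag_block_mat [mat 1 1 (\<lambda>_. c), L]"

definition spectral_data :: "nat \<Rightarrow> mixing_data \<Rightarrow> bool" where
  "spectral_data n S \<longleftrightarrow>
     mW S \<in> carrier_mat n n \<and> mA S \<in> carrier_mat n n \<and>
     mB S \<in> carrier_mat n n \<and> mC S \<in> carrier_mat n n \<and>
     (\<forall>L \<in> {Lam S, Lam_a S, Lam_b S, Lam_c S}. L \<in> carrier_mat (n - 1) (n - 1) \<and> diagonal_mat L) \<and>
     pos_def (Lam_b S) \<and>
     mU S \<in> carrier_mat n n \<and> transpose_mat (mU S) * mU S = 1\<^sub>m n \<and>
     col (mU S) 0 = vec n (\<lambda>_. 1 / sqrt (real n)) \<and>
     mW S = mU S * diag_cons 1 (Lam S) * transpose_mat (mU S) \<and>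
     mA S = mU S * diag_cons 1 (Lam_a S) * transpose_mat (mU S) \<and>
     mB S * mB S = mU S * diag_cons 0 (Lam_b S * Lam_b S) * transpose_mat (mU S) \<and>
     mC S = mU S * diag_cons 1 (Lam_c S) * transpose_mat (mU S)"

(* B_s is the positive semidefinite square root of I - W_s. *)
definition uses_ED :: "nat \<Rightarrow> mixing_data \<Rightarrow> bool" where
  "uses_ED n S \<longleftrightarrow> mA S = mW S \<and>
     pos_semidef (mB S) \<and> mB S * mB S = 1\<^sub>m n - mW S \<and> mC S = mW S"

definition uses_GT :: "nat \<Rightarrow> mixing_data \<Rightarrow> bool" where
  "uses_GT n S \<longleftrightarrow> mA S = mW S * mW S \<and> mB S = 1\<^sub>m n - mW S \<and> mC S = mW S * mW S"

(* Bold letters: the Kronecker product with the identity of the dimension d of the variable. *)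
definition bold :: "nat \<Rightarrow> real mat \<Rightarrow> real mat" where
  "bold d L = kronecker L (1\<^sub>m d)"

definition M_mat :: "nat \<Rightarrow> mixing_data \<Rightarrow> real mat" where
  "M_mat d S =
     (let b = bold d (Lam_b S); c = bold d (Lam_c S)
      in four_block_mat (c - b * b) (- b) b (1\<^sub>m (dim_row b)))"

definition is_factorization :: "real mat \<Rightarrow> real mat \<Rightarrow> real mat \<Rightarrow> bool" where
  "is_factorization M P G \<longleftrightarrow>
     P \<in> carrier_mat (dim_row M) (dim_row M) \<and> G \<in> carrier_mat (dim_row M) (dim_row M) \<and>
     invertible_mat P \<and> M = P * G * inv_mat P \<and> spectral_norm G < 1"

(* In the following definitions P and G are the factors O_s and Gamma_s. *)

definition delta_yz :: "nat \<Rightarrow> mixing_data \<Rightarrow> real mat \<Rightarrow> real mat \<Rightarrow> real" where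
  "delta_yz d S P G =
     ((spectral_norm P)\<^sup>2 * (spectral_norm (inv_mat P))\<^sup>2 / (1 - spectral_norm G))\<^sup>2 *
     (spectral_norm (bold d (Lam_a S)))\<^sup>2"

definition delta_hat_yz :: "nat \<Rightarrow> mixing_data \<Rightarrow> real mat \<Rightarrow> real mat \<Rightarrow> real" where
  "delta_hat_yz d S P G =
     (spectral_norm P * spectral_norm (inv_mat P) * spectral_norm (inv_mat (bold d (Lam_b S))) /
      (1 - spectral_norm G)) powr (4 / 3)"

definition delta_x :: "nat \<Rightarrow> mixing_data \<Rightarrow> real mat \<Rightarrow> real mat \<Rightarrow> real" where
  "delta_x d S P G =
     (spectral_norm P * spectral_norm (inv_mat P) / (1 - spectral_norm G) *
      spectral_norm (bold d (Lam_a S)))\<^sup>2"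

definition delta_hat_x :: "nat \<Rightarrow> mixing_data \<Rightarrow> real mat \<Rightarrow> real mat \<Rightarrow> real" where
  "delta_hat_x d S P G =
     ((spectral_norm P)\<^sup>2 * (spectral_norm (inv_mat P))\<^sup>2 *
      (spectral_norm (inv_mat (bold d (Lam_b S))))\<^sup>2 / (1 - spectral_norm G)) powr (2 / 3) +
     spectral_norm P * spectral_norm (inv_mat P) * spectral_norm (inv_mat (bold d (Lam_b S))) /
      (1 - spectral_norm G)"

definition transient_complexity ::
    "nat \<Rightarrow> real \<Rightarrow> real \<Rightarrow> real \<Rightarrow> real \<Rightarrow> real \<Rightarrow> real \<Rightarrow> real" where
  "transient_complexity n dx dy dz hx hy hz =
     Max {real n ^ 2 * dx, real n ^ 3 * dy, real n ^ 3 * dz, real n * hx, real n * hy, real n * hz}"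

end

theory Submission
  imports Defs
begin

text \<open>
  Diagonalising \<open>W\<close> turns \<open>M\<close> into a direct sum of 2x2 blocks, one for each eigenvalue
  \<open>\<lambda> \<in> [rho_min, \<rho>]\<close> (with multiplicity), and each block is factored by hand.
  For ED, with \<open>s = sqrt (1 - \<lambda>)\<close>, the block has the complex eigenvalues
  \<open>\<lambda> \<plusminus> i s sqrt \<lambda>\<close> of modulus \<open>sqrt \<lambda>\<close>; in a suitable real basis, of condition number
  at most \<open>2 / sqrt rho_min\<close>, it is a scaled rotation, and \<open>1 - sqrt \<rho> \<ge> (1 - \<rho>) / 2\<close>.
  For GT the block is defective with the double eigenvalue \<open>\<lambda>\<close>; rescaling one basis vector
  shrinks the nilpotent part to \<open>(1 - \<lambda>) / 2\<close>, so that the norm is at most \<open>(1 + \<lambda>) / 2\<close>.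
  In both cases \<open>1 - \<parallel>\<Gamma>\<parallel>\<close> lies between \<open>(1 - \<rho>) / 2\<close> and \<open>1 - \<rho>\<close>. Since
  \<open>\<parallel>\<Lambda>\<^sub>b\<^sup>-\<^sup>1\<parallel>\<close> is \<open>(1 - \<rho>) powr (-1/2)\<close> for ED and \<open>1 / (1 - \<rho>)\<close> for GT, all six
  quantities are at most of order \<open>(1 - \<rho>) powr -2\<close>, and the lower bound on the complexity already
  comes from \<open>n^3 \<delta>\<^sub>y\<close>, because the condition number is at least 1 and \<open>\<parallel>\<Lambda>\<^sub>a\<parallel> \<ge> rho_min\<close>.
\<close>

section \<open>Spectral norms of block-diagonal matrices\<close>

lemma scalar_prod_self: "v \<bullet> v = (\<Sum>i<dim_vec v. (v $ i)\<^sup>2)" for v :: "real vec"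
  by (simp add: scalar_prod_def lessThan_atLeast0 power2_eq_square)

lemma vnorm_power2: "(vnorm v)\<^sup>2 = (\<Sum>i<dim_vec v. (v $ i)\<^sup>2)"
  by (simp add: vnorm_def scalar_prod_self sum_nonneg)

lemma vnorm_nonneg: "0 \<le> vnorm v"
  by (simp add: vnorm_def scalar_prod_self sum_nonneg)

lemma spectral_norm_le:
  assumes "\<And>v. v \<in> carrier_vec (dim_col A) \<Longrightarrow> vnorm v \<le> 1 \<Longrightarrow> vnorm (A *\<^sub>v v) \<le> K"
  shows "spectral_norm A \<le> K"
proof -
  have "vnorm (0\<^sub>v (dim_col A)) \<le> 1"
    by (simp add: vnorm_def)
  then have "{v \<in> carrier_vec (dim_col A). vnorm v \<le> 1} \<noteq> {}"
    by (auto intro!: exI[of _ "0\<^sub>v (dim_col A)"])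
  with assms show ?thesis
    unfolding spectral_norm_def by (intro cSUP_least) auto
qed

text \<open>The entry is a coordinate of the image of a unit vector. The hypothesis
  \<open>bound\<close> makes the set under the \<open>SUP\<close> bounded above; otherwise the real
  supremum would be unspecified.\<close>

lemma entry_le_spectral_norm:
  assumes bound: "\<And>v. v \<in> carrier_vec (dim_col A) \<Longrightarrow> vnorm v \<le> 1 \<Longrightarrow> vnorm (A *\<^sub>v v) \<le> K"
    and i: "i < dim_row A" and j: "j < dim_col A"
  shows "\<bar>A $$ (i, j)\<bar> \<le> spectral_norm A"
proof -
  let ?u = "unit_vec (dim_col A) j :: real vec"
  have "vnorm ?u = 1"
    using j by (simp add: vnorm_def)
  then have "vnorm (A *\<^sub>v ?u) \<le> spectral_norm A"
    unfolding spectral_norm_def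
    by (intro cSUP_upper bdd_aboveI2[where M = K]) (auto intro: bound)
  moreover have "(A *\<^sub>v ?u) $ i = A $$ (i, j)"
    using i j by simp
  then have "(A $$ (i, j))\<^sup>2 \<le> (vnorm (A *\<^sub>v ?u))\<^sup>2"
    unfolding vnorm_power2 using i
    by (metis (no_types, lifting) dim_mult_mat_vec finite_lessThan lessThan_iff member_le_sum
        zero_le_power2)
  then have "\<bar>A $$ (i, j)\<bar> \<le> vnorm (A *\<^sub>v ?u)"
    using vnorm_nonneg by (simp add: abs_le_square_iff[symmetric])
  ultimately show ?thesis by linarith
qed

text \<open>\<open>inv_mat\<close> applies \<open>the\<close> to an option. A right inverse of a
  square matrix is also a left inverse, so \<open>A\<close> is a unit and
  \<open>mat_inverse A\<close> cannot be \<open>None\<close>; uniqueness of inverses identifies its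
  value with \<open>B\<close>.\<close>

lemma inv_mat_eqI:
  assumes "A \<in> carrier_mat n n" "B \<in> carrier_mat n n" "A * B = 1\<^sub>m n"
  shows "inv_mat A = B"
proof -
  have BA: "B * A = 1\<^sub>m n"
    using assms by (rule mat_mult_left_right_inverse)
  then have "A \<in> Units (ring_mat TYPE(real) n ())"
    using assms unfolding Units_def ring_mat_def by auto
  then obtain D where D: "mat_inverse A = Some D"
    using mat_inverse(1)[OF assms(1), of "()"] by (cases "mat_inverse A") blast+
  then have "A * D = 1\<^sub>m n" "D \<in> carrier_mat n n"
    using mat_inverse(2)[OF assms(1)] by auto
  then have "B * (A * D) = B" "B * A * D = D"
    using BA assms by auto
  moreover have "B * (A * D) = B * A * D"
    using \<open>D \<in> _\<close> assms by (intro assoc_mult_mat[symmetric]) auto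
  ultimately have "D = B" by simp
  with D show ?thesis by simp
qed

section \<open>Diagonal matrices and their norms\<close>

lemma mat_diag_mult_vec:
  "v \<in> carrier_vec n \<Longrightarrow> mat_diag n f *\<^sub>v v = vec n (\<lambda>i. f i * v $ i)"
  for f :: "nat \<Rightarrow> real"
  by (auto simp: mat_diag_def scalar_prod_def if_distrib[of "\<lambda>x. x * _"] sum.delta' cong: if_cong)

lemma mat_diag_add: "mat_diag n f + mat_diag n g = mat_diag n (\<lambda>i. f i + g i)"
  for f g :: "nat \<Rightarrow> real"
  by (auto simp: mat_diag_def)

lemma vnorm_mat_diag_le:
  assumes "\<And>i. i < n \<Longrightarrow> \<bar>f i\<bar> \<le> K" "0 \<le> K" "v \<in> carrier_vec n" "vnorm v \<le> 1"
  shows "vnorm (mat_diag n f *\<^sub>v v) \<le> K"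
proof (rule power2_le_imp_le)
  have "(vnorm (mat_diag n f *\<^sub>v v))\<^sup>2 = (\<Sum>i<n. (f i)\<^sup>2 * (v $ i)\<^sup>2)"
    using assms by (simp add: mat_diag_mult_vec vnorm_power2 power_mult_distrib)
  also have "\<dots> \<le> (\<Sum>i<n. K\<^sup>2 * (v $ i)\<^sup>2)"
    using assms by (intro sum_mono mult_right_mono) (auto simp: abs_le_square_iff[symmetric])
  also have "\<dots> = K\<^sup>2 * (vnorm v)\<^sup>2"
    using assms by (simp add: vnorm_power2 sum_distrib_left)
  also have "\<dots> \<le> K\<^sup>2"
    using assms vnorm_nonneg[of v] by (simp add: mult_left_le power_le_one)
  finally show "(vnorm (mat_diag n f *\<^sub>v v))\<^sup>2 \<le> K\<^sup>2" .
qed (fact assms)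

lemma spectral_norm_mat_diag_le:
  assumes "\<And>i. i < n \<Longrightarrow> \<bar>f i\<bar> \<le> K" "0 \<le> K"
  shows "spectral_norm (mat_diag n f) \<le> K"
  using assms by (intro spectral_norm_le vnorm_mat_diag_le) (auto simp: mat_diag_def)

lemma abs_le_spectral_norm_mat_diag:
  assumes "i < n"
  shows "\<bar>f i\<bar> \<le> spectral_norm (mat_diag n f)"
proof -
  have "\<bar>mat_diag n f $$ (i, i)\<bar> \<le> spectral_norm (mat_diag n f)"
  proof (rule entry_le_spectral_norm[where K = "\<Sum>i<n. \<bar>f i\<bar>"])
    show "vnorm (mat_diag n f *\<^sub>v v) \<le> (\<Sum>i<n. \<bar>f i\<bar>)"
      if "v \<in> carrier_vec (dim_col (mat_diag n f))" "vnorm v \<le> 1" for v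
      using that by (intro vnorm_mat_diag_le member_le_sum sum_nonneg) (auto simp: mat_diag_def)
  qed (use assms in \<open>auto simp: mat_diag_def\<close>)
  with assms show ?thesis by (simp add: mat_diag_def)
qed

text \<open>Up to reordering coordinates so that \<open>i\<close> is paired with
  \<open>N + i\<close>, this is the direct sum of the 2x2 matrices with rows
  \<open>(a i, b i)\<close> and \<open>(c i, d i)\<close>. Keeping four diagonal blocks matches the
  shape of \<open>M_mat\<close> and lets products, inverses and norms be treated pair by pair
  without a permutation matrix.\<close>

definition diag_blocks ::
    "nat \<Rightarrow> (nat \<Rightarrow> real) \<Rightarrow> (nat \<Rightarrow> real) \<Rightarrow> (nat \<Rightarrow> real) \<Rightarrow> (nat \<Rightarrow> real) \<Rightarrow> real mat" where
  "diag_blocks N a b c d =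
     four_block_mat (mat_diag N a) (mat_diag N b) (mat_diag N c) (mat_diag N d)"

lemma diag_blocks_carrier [simp]: "diag_blocks N a b c d \<in> carrier_mat (2 * N) (2 * N)"
  unfolding diag_blocks_def mult_2 by (intro four_block_carrier_mat) auto

lemma dim_diag_blocks [simp]:
  "dim_row (diag_blocks N a b c d) = 2 * N" "dim_col (diag_blocks N a b c d) = 2 * N"
  using diag_blocks_carrier[of N a b c d] by (auto simp del: diag_blocks_carrier)

lemma diag_blocks_mult:
  "diag_blocks N a b c d * diag_blocks N a' b' c' d' =
     diag_blocks N (\<lambda>i. a i * a' i + b i * c' i) (\<lambda>i. a i * b' i + b i * d' i)
       (\<lambda>i. c i * a' i + d i * c' i) (\<lambda>i. c i * b' i + d i * d' i)"
  unfolding diag_blocks_def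
  by (subst mult_four_block_mat[of _ N N _ N _ N _ _ N _ N]) (simp_all add: mat_diag_add)

lemma mat_diag_cong: "(\<And>i. i < n \<Longrightarrow> f i = g i) \<Longrightarrow> mat_diag n f = mat_diag n g"
  by (auto simp: mat_diag_def)

lemma diag_blocks_cong:
  assumes "\<And>i. i < N \<Longrightarrow> a i = a' i \<and> b i = b' i \<and> c i = c' i \<and> d i = d' i"
  shows "diag_blocks N a b c d = diag_blocks N a' b' c' d'"
  unfolding diag_blocks_def using assms by (intro cong_four_block_mat mat_diag_cong) auto

lemma diag_blocks_one: "diag_blocks N (\<lambda>_. 1) (\<lambda>_. 0) (\<lambda>_. 0) (\<lambda>_. 1) = 1\<^sub>m (2 * N)"
proof -
  have "mat_diag N (\<lambda>_. 0 :: real) = 0\<^sub>m N N"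
    by (auto simp: mat_diag_def)
  then show ?thesis by (simp add: diag_blocks_def mult_2)
qed

lemma vnorm_diag_blocks_le:
  assumes bound: "\<And>i x y. i < N \<Longrightarrow>
      (a i * x + b i * y)\<^sup>2 + (c i * x + d i * y)\<^sup>2 \<le> K\<^sup>2 * (x\<^sup>2 + y\<^sup>2)"
    and K: "0 \<le> K" and v: "v \<in> carrier_vec (2 * N)" "vnorm v \<le> 1"
  shows "vnorm (diag_blocks N a b c d *\<^sub>v v) \<le> K"
proof (rule power2_le_imp_le[OF _ K])
  define x where "x = vec_first v N"
  define y where "y = vec_last v N"
  have dim: "x \<in> carrier_vec N" "y \<in> carrier_vec N"
    by (simp_all add: x_def y_def)
  have v_eq: "v = x @\<^sub>v y"
    using v by (simp add: x_def y_def mult_2)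
  \<comment> \<open>Regrouping the squared norm by pairs of coordinates reduces the estimate to
    \<open>bound\<close> for each single 2x2 block.\<close>
  have split: "(vnorm (u @\<^sub>v w))\<^sup>2 = (\<Sum>i<N. (u $ i)\<^sup>2 + (w $ i)\<^sup>2)"
    if "u \<in> carrier_vec N" "w \<in> carrier_vec N" for u w
  proof -
    have "(vnorm (u @\<^sub>v w))\<^sup>2 = u \<bullet> u + w \<bullet> w"
      using that unfolding vnorm_def
      by (subst scalar_prod_append[of _ N _ N]) (auto simp: scalar_prod_self sum_nonneg)
    also have "\<dots> = (\<Sum>i<N. (u $ i)\<^sup>2) + (\<Sum>i<N. (w $ i)\<^sup>2)"
      using that by (simp add: scalar_prod_self)
    finally show ?thesis by (simp add: sum.distrib)
  qed
  have "diag_blocks N a b c d *\<^sub>v v =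
      vec N (\<lambda>i. a i * x $ i + b i * y $ i) @\<^sub>v vec N (\<lambda>i. c i * x $ i + d i * y $ i)"
    unfolding v_eq diag_blocks_def using dim
    by (subst four_block_mat_mult_vec[of _ N N _ N _ N]) (auto simp: mat_diag_mult_vec)
  then have "(vnorm (diag_blocks N a b c d *\<^sub>v v))\<^sup>2 =
      (\<Sum>i<N. (a i * x $ i + b i * y $ i)\<^sup>2 + (c i * x $ i + d i * y $ i)\<^sup>2)"
    by (simp add: split)
  also have "\<dots> \<le> (\<Sum>i<N. K\<^sup>2 * ((x $ i)\<^sup>2 + (y $ i)\<^sup>2))"
    using bound by (intro sum_mono) auto
  also have "\<dots> = K\<^sup>2 * (vnorm v)\<^sup>2"
    unfolding v_eq split[OF dim] by (simp add: sum_distrib_left)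
  also have "\<dots> \<le> K\<^sup>2"
    using v vnorm_nonneg[of v] by (simp add: mult_left_le power_le_one)
  finally show "(vnorm (diag_blocks N a b c d *\<^sub>v v))\<^sup>2 \<le> K\<^sup>2" .
qed

lemma spectral_norm_diag_blocks_le:
  assumes "\<And>i x y. i < N \<Longrightarrow>
      (a i * x + b i * y)\<^sup>2 + (c i * x + d i * y)\<^sup>2 \<le> K\<^sup>2 * (x\<^sup>2 + y\<^sup>2)"
    and "0 \<le> K"
  shows "spectral_norm (diag_blocks N a b c d) \<le> K"
  using assms by (intro spectral_norm_le vnorm_diag_blocks_le) auto

text \<open>Cauchy-Schwarz for each row, with the defect displayed as a sum of two squares
  (Lagrange's identity).\<close>

lemma frobenius_bound:
  "(a * x + b * y)\<^sup>2 + (c * x + d * y)\<^sup>2 \<le> (a\<^sup>2 + b\<^sup>2 + c\<^sup>2 + d\<^sup>2) * (x\<^sup>2 + y\<^sup>2)"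
  for a b c d x y :: real
proof -
  have "(a\<^sup>2 + b\<^sup>2 + c\<^sup>2 + d\<^sup>2) * (x\<^sup>2 + y\<^sup>2) - ((a * x + b * y)\<^sup>2 + (c * x + d * y)\<^sup>2)
      = (a * y - b * x)\<^sup>2 + (c * y - d * x)\<^sup>2"
    by (simp add: power2_eq_square algebra_simps)
  then show ?thesis
    using zero_le_power2[of "a * y - b * x"] zero_le_power2[of "c * y - d * x"] by linarith
qed

lemma frobenius_bound_le:
  assumes "a\<^sup>2 + b\<^sup>2 + c\<^sup>2 + d\<^sup>2 \<le> (K::real)"
  shows "(a * x + b * y)\<^sup>2 + (c * x + d * y)\<^sup>2 \<le> K * (x\<^sup>2 + y\<^sup>2)"
  using frobenius_bound[of a x b y c d] mult_right_mono[OF assms, of "x\<^sup>2 + y\<^sup>2"] by fastforce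

lemma abs_le_spectral_norm_diag_blocks:
  assumes "i < N"
  shows "\<bar>a i\<bar> \<le> spectral_norm (diag_blocks N a b c d)"
proof -
  let ?A = "diag_blocks N a b c d"
  let ?f = "\<lambda>i. (a i)\<^sup>2 + (b i)\<^sup>2 + (c i)\<^sup>2 + (d i)\<^sup>2"
  \<comment> \<open>Summing the squared Frobenius norms of all blocks is crude, but some finite
    bound is all that boundedness of the supremum requires.\<close>
  have "vnorm (?A *\<^sub>v v) \<le> sqrt (\<Sum>i<N. ?f i)"
    if "v \<in> carrier_vec (dim_col ?A)" "vnorm v \<le> 1" for v
  proof (rule vnorm_diag_blocks_le)
    fix i x y assume "i < N"
    then have "?f i \<le> (\<Sum>i<N. ?f i)"
      by (intro member_le_sum) auto
    then show "(a i * x + b i * y)\<^sup>2 + (c i * x + d i * y)\<^sup>2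
        \<le> (sqrt (\<Sum>i<N. ?f i))\<^sup>2 * (x\<^sup>2 + y\<^sup>2)"
      by (subst real_sqrt_pow2) (auto intro: frobenius_bound_le sum_nonneg)
  qed (use that in \<open>auto intro!: sum_nonneg\<close>)
  from entry_le_spectral_norm[of ?A, OF this, of i i] assms show ?thesis
    by (simp add: diag_blocks_def mat_diag_def)
qed

section \<open>Simultaneous diagonalisation of the mixing data\<close>

lemma diagonal_mat_eq_mat_diag:
  assumes "L \<in> carrier_mat m m" "diagonal_mat L"
  shows "L = mat_diag m (\<lambda>i. L $$ (i, i))"
  using assms by (auto simp: mat_diag_def diagonal_mat_def)

lemma diag_cons_mat_diag: "diag_cons c (mat_diag m f) = mat_diag (Suc m) (case_nat c f)"
  by (rule eq_matI)
    (auto simp: diag_cons_def mat_diag_def Let_def four_block_mat_def split: nat.splits)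

text \<open>Tensoring with the identity repeats every diagonal entry \<open>d\<close> times, so the
  dimension of the variable changes multiplicities only. This is why the final constants do not
  depend on the dimensions.\<close>

lemma bold_mat_diag: "bold d (mat_diag m f) = mat_diag (m * d) (\<lambda>i. f (i div d))"
proof (rule eq_matI)
  fix i j assume "i < dim_row (mat_diag (m * d) (\<lambda>i. f (i div d)))"
    "j < dim_col (mat_diag (m * d) (\<lambda>i. f (i div d)))"
  then have ij: "i < m * d" "j < m * d"
    by (auto simp: mat_diag_def)
  then have "0 < d"
    by (cases d) auto
  moreover have "i = j \<longleftrightarrow> i div d = j div d \<and> i mod d = j mod d"
    by (metis div_mult_mod_eq)
  ultimately show "bold d (mat_diag m f) $$ (i, j) = mat_diag (m * d) (\<lambda>i. f (i div d)) $$ (i, j)"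
    using ij by (auto simp: bold_def kronecker_def mat_diag_def less_mult_imp_div_less)
qed (auto simp: bold_def kronecker_def mat_diag_def)

lemma inv_mat_mat_diag:
  assumes "\<And>i. i < n \<Longrightarrow> f i \<noteq> 0"
  shows "inv_mat (mat_diag n f) = mat_diag n (\<lambda>i. inverse (f i))"
proof (rule inv_mat_eqI)
  show "mat_diag n f * mat_diag n (\<lambda>i. inverse (f i)) = 1\<^sub>m n"
    using assms by (subst mat_diag_one[symmetric]) (simp del: mat_diag_one cong: mat_diag_cong)
qed auto

lemma char_poly_mat_diag: "char_poly (mat_diag n f) = (\<Prod>i\<leftarrow>[0..<n]. [:- f i, 1:])"
  for f :: "nat \<Rightarrow> real"
proof -
  have "upper_triangular (mat_diag n f)"
    by (auto simp: mat_diag_def)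
  moreover have "diag_mat (mat_diag n f) = map f [0..<n]"
    by (auto simp: diag_mat_def mat_diag_def)
  ultimately show ?thesis
    by (simp add: char_poly_upper_triangular[of _ n] comp_def)
qed

lemma proots_char_poly_mat_diag:
  "proots (char_poly (mat_diag n f)) = mset (map f [0..<n])" for f :: "nat \<Rightarrow> real"
proof -
  \<comment> \<open>An arbitrary list replaces \<open>[0..<n]\<close> so that structural induction
    applies.\<close>
  have "proots (\<Prod>i\<leftarrow>is. [:- f i, 1:]) = mset (map f is)" for "is"
    by (induction "is")
      (simp_all add: proots_mult prod_list_zero_iff image_iff del: mult_pCons_left mult_pCons_right)
  then show ?thesis by (simp add: char_poly_mat_diag)
qed

section \<open>Conjugation by an orthogonal matrix\<close>

lemma conj_mult:
  fixes U D E :: "real mat"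
  assumes "U \<in> carrier_mat n n" "transpose_mat U * U = 1\<^sub>m n"
    "D \<in> carrier_mat n n" "E \<in> carrier_mat n n"
  shows "(U * D * transpose_mat U) * (U * E * transpose_mat U) = U * (D * E) * transpose_mat U"
proof -
  have "(U * D * transpose_mat U) * (U * E * transpose_mat U)
      = U * D * (transpose_mat U * U) * E * transpose_mat U"
    using assms(1,3,4) by (simp add: assoc_mult_mat[of _ n n _ n _ n])
  also have "\<dots> = U * (D * E) * transpose_mat U"
    using assms by (simp add: assoc_mult_mat[of _ n n _ n _ n])
  finally show ?thesis .
qed

lemma conj_cancel:
  fixes U D E :: "real mat"
  assumes "U \<in> carrier_mat n n" "transpose_mat U * U = 1\<^sub>m n"
    "D \<in> carrier_mat n n" "E \<in> carrier_mat n n"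
    and eq: "U * D * transpose_mat U = U * E * transpose_mat U"
  shows "D = E"
proof -
  have "transpose_mat U * (U * F * transpose_mat U) * U = F" if "F \<in> carrier_mat n n" for F
  proof -
    have "transpose_mat U * (U * F * transpose_mat U) * U
        = (transpose_mat U * U) * F * (transpose_mat U * U)"
      using assms(1) that by (simp add: assoc_mult_mat[of _ n n _ n _ n])
    then show ?thesis using assms that by simp
  qed
  from this[OF assms(3), unfolded eq] this[OF assms(4)] show ?thesis by (rule trans[OF sym])
qed

lemma one_minus_conj:
  fixes U D :: "real mat"
  assumes "U \<in> carrier_mat n n" "transpose_mat U * U = 1\<^sub>m n" "D \<in> carrier_mat n n"
  shows "1\<^sub>m n - U * D * transpose_mat U = U * (1\<^sub>m n - D) * transpose_mat U"
proof -
  have "U * transpose_mat U = 1\<^sub>m n"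
    using assms by (intro mat_mult_left_right_inverse[of "transpose_mat U"]) auto
  moreover have "U * (1\<^sub>m n - D) = U * 1\<^sub>m n - U * D"
    using assms by (intro mult_minus_distrib_mat) auto
  moreover have "(U * 1\<^sub>m n - U * D) * transpose_mat U
      = U * 1\<^sub>m n * transpose_mat U - U * D * transpose_mat U"
    using assms by (intro minus_mult_distrib_mat) auto
  ultimately show ?thesis
    using assms(1) by simp
qed

lemma one_minus_mat_diag: "1\<^sub>m n - mat_diag n f = mat_diag n (\<lambda>i. 1 - f i)"
  for f :: "nat \<Rightarrow> real"
  by (auto simp: mat_diag_def)

lemma mat_diag_eqD: "mat_diag n f = mat_diag n g \<Longrightarrow> i < n \<Longrightarrow> f i = g i"
  by (drule arg_cong[where f = "\<lambda>A. A $$ (i, i)"]) (simp add: mat_diag_def)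

lemma pos_def_mat_diagD:
  assumes "pos_def (mat_diag n f)" "i < n"
  shows "0 < f i"
proof -
  have "0 < unit_vec n i \<bullet> (mat_diag n f *\<^sub>v unit_vec n i)"
    using assms by (auto simp: pos_def_def mat_diag_def dest: bspec[of _ _ "unit_vec n i"])
  then show ?thesis
    using assms by (simp add: mat_diag_mult_vec)
qed

lemma eigvals_conj_mat_diag:
  assumes U: "U \<in> carrier_mat n n" "transpose_mat U * U = 1\<^sub>m n"
  shows "eigvals_desc (U * mat_diag n f * transpose_mat U) = rev (sort (map f [0..<n]))"
proof -
  have "U * transpose_mat U = 1\<^sub>m n"
    using U by (intro mat_mult_left_right_inverse[of "transpose_mat U"]) auto
  with U have "similar_mat (U * mat_diag n f * transpose_mat U) (mat_diag n f)"
    unfolding similar_mat_def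
    by (intro exI[of _ U] exI[of _ "transpose_mat U"] similar_mat_witI[of _ _ n]) auto
  then show ?thesis
    unfolding eigvals_desc_def
    by (simp add: char_poly_similar proots_char_poly_mat_diag del: mset_map)
qed

lemma mixing_matrix_eigenvalues:
  assumes W: "mixing_matrix r n W" and r: "0 < r" and m: "n = Suc m" "0 < m"
    and U: "U \<in> carrier_mat n n" "transpose_mat U * U = 1\<^sub>m n"
    and W_eq: "W = U * diag_cons 1 (mat_diag m l) * transpose_mat U"
  shows "\<And>i. i < m \<Longrightarrow> r \<le> l i \<and> l i \<le> mixing_rho W"
    and "\<exists>i<m. l i = mixing_rho W" and "mixing_rho W < 1"
proof -
  let ?e = "eigvals_desc W"
  have e: "?e = rev (sort (map (case_nat 1 l) [0..<n]))"
    unfolding W_eq diag_cons_mat_diag m(1)[symmetric] by (rule eigvals_conj_mat_diag[OF U])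
  then have len: "length ?e = n" by simp
  then obtain ys where ys: "?e = 1 # ys"
    using W m by (cases ?e) (auto simp: mixing_matrix_def)
  \<comment> \<open>Cancelling one copy of \<open>1\<close> from both multisets identifies
    \<open>ys\<close> with the values of \<open>l\<close>, with no need to track where sorting moves
    the entry at index 0.\<close>
  have "mset ?e = add_mset 1 (mset (map l [0..<m]))"
    unfolding e m(1) by (simp add: upt_conv_Cons map_Suc_upt[symmetric] comp_def del: upt_Suc)
  then have mset_ys: "mset ys = mset (map l [0..<m])"
    by (simp add: ys)
  have "sorted (rev ?e)"
    by (simp add: e)
  then have sorted: "sorted (rev ys)"
    by (simp add: ys sorted_append)
  have ne: "ys \<noteq> []"
    using len m by (auto simp: ys)
  have set_ys: "set ys = l ` {..<m}"
    using mset_eq_setD[OF mset_ys] by (auto simp: atLeast0LessThan)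
  have "last ys \<le> y \<and> y \<le> hd ys" if "y \<in> set ys" for y
  proof
    show "last ys \<le> y"
      using sorted that by (cases ys rule: rev_cases) auto
    show "y \<le> hd ys"
      using sorted that by (cases ys) (auto simp: sorted_append)
  qed
  moreover have "r \<le> last ys" "mixing_rho W = max \<bar>hd ys\<bar> \<bar>last ys\<bar>"
    using W ne by (simp_all add: mixing_matrix_def mixing_rho_def ys hd_conv_nth)
  ultimately have rho: "mixing_rho W = hd ys"
    and bd: "\<And>y. y \<in> set ys \<Longrightarrow> r \<le> y \<and> y \<le> hd ys"
    using r ne hd_in_set[OF ne] by fastforce+
  show "\<And>i. i < m \<Longrightarrow> r \<le> l i \<and> l i \<le> mixing_rho W"
    using bd by (auto simp: set_ys rho)
  show "\<exists>i<m. l i = mixing_rho W"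
    using hd_in_set[OF ne] by (auto simp: set_ys rho)
  show "mixing_rho W < 1"
    using W by (simp add: mixing_matrix_def)
qed

text \<open>All matrices are replaced by functions listing their diagonal entries.
  \<open>case_nat\<close> prepends the entry belonging to the first column of \<open>mU S\<close>,
  so entry \<open>i\<close> of a Lambda matrix sits at index \<open>Suc i\<close>. For
  \<open>mB S\<close> only the square is diagonalised, as in \<open>spectral_data\<close>.\<close>

locale mixing_spectra =
  fixes r :: real and n m :: nat and S :: mixing_data and l a b c :: "nat \<Rightarrow> real"
  assumes r: "0 < r" and mixing: "mixing_matrix r n (mW S)"
    and m: "n = Suc m" "0 < m"
    and Lam: "Lam_a S = mat_diag m a" "Lam_b S = mat_diag m b" "Lam_c S = mat_diag m c"
    and W: "mW S = mU S * mat_diag n (case_nat 1 l) * transpose_mat (mU S)"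
    and A: "mA S = mU S * mat_diag n (case_nat 1 a) * transpose_mat (mU S)"
    and B: "mB S * mB S = mU S * mat_diag n (case_nat 0 (\<lambda>i. b i * b i)) * transpose_mat (mU S)"
    and C: "mC S = mU S * mat_diag n (case_nat 1 c) * transpose_mat (mU S)"
    and b_pos: "\<And>i. i < m \<Longrightarrow> 0 < b i"
    and U: "mU S \<in> carrier_mat n n" "transpose_mat (mU S) * mU S = 1\<^sub>m n"

lemma mixing_spectraE:
  assumes "0 < r" "mixing_matrix r n (mW S)" "spectral_data n S" "2 \<le> n"
  obtains m l a b c where "mixing_spectra r n m S l a b c"
proof -
  obtain m where m: "n = Suc m" "0 < m"
    using assms(4) by (cases n) auto
  note S = assms(3)[unfolded spectral_data_def]
  have "\<exists>f. L = mat_diag m f" if "L \<in> {Lam S, Lam_a S, Lam_b S, Lam_c S}" for L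
    using diagonal_mat_eq_mat_diag[of L m] S that m(1) by fastforce
  then obtain l a b c where L: "Lam S = mat_diag m l" "Lam_a S = mat_diag m a"
    "Lam_b S = mat_diag m b" "Lam_c S = mat_diag m c"
    by (metis insertI1 insertI2)
  note eqs = L diag_cons_mat_diag[of _ m, folded m(1)]
  have "mixing_spectra r n m S l a b c"
  proof
    show "0 < b i" if "i < m" for i
      using pos_def_mat_diagD[of m b i] S that L(3) by simp
  qed (use S assms m in \<open>simp_all add: eqs\<close>)
  then show thesis by (rule that)
qed

context mixing_spectra
begin

abbreviation "rho \<equiv> mixing_rho (mW S)"

lemma eigenvalue_bounds:
  shows "\<And>i. i < m \<Longrightarrow> r \<le> l i" "\<And>i. i < m \<Longrightarrow> l i \<le> rho" "\<exists>i<m. l i = rho" "rho < 1"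
  using mixing_matrix_eigenvalues[OF mixing r m U, of l] W
  by (simp_all add: diag_cons_mat_diag m(1)[symmetric])

lemma rho_ge: "r \<le> rho"
  using eigenvalue_bounds(1,3) by metis

lemma conj_eqD:
  assumes "mU S * mat_diag n f * transpose_mat (mU S) = mU S * mat_diag n g * transpose_mat (mU S)"
    and "i < m"
  shows "f (Suc i) = g (Suc i)"
  using assms(2) mat_diag_eqD[OF conj_cancel[OF U mat_diag_dim mat_diag_dim assms(1)]]
  by (simp add: m(1))

lemma ED_spectra:
  assumes ED: "uses_ED n S" and i: "i < m"
  shows "a i = l i" "b i = sqrt (1 - l i)" "c i = l i"
proof -
  show "a i = l i" "c i = l i"
    using conj_eqD[of "case_nat 1 a" "case_nat 1 l" i] conj_eqD[of "case_nat 1 c" "case_nat 1 l" i]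
      i A C W ED by (simp_all add: uses_ED_def)
  have "mB S * mB S = 1\<^sub>m n - mW S"
    using ED by (simp add: uses_ED_def)
  also have "\<dots> = mU S * mat_diag n (\<lambda>i. 1 - case_nat 1 l i) * transpose_mat (mU S)"
    unfolding W by (subst one_minus_conj) (simp_all add: U one_minus_mat_diag)
  finally have "b i * b i = 1 - l i"
    unfolding B by (auto dest!: conj_eqD[OF _ i])
  then have "1 - l i = b i * b i" by simp
  then show "b i = sqrt (1 - l i)"
    using b_pos[OF i] by simp
qed

text \<open>Since only the square of \<open>mB S\<close> is given in diagonal form, the GT matrix
  \<open>I - W\<close> is squared first. Comparing entries determines \<open>b i\<close> up to sign,
  and the sign follows from \<open>b i > 0\<close> and \<open>l i < 1\<close>.\<close>

lemma GT_spectra: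
  assumes GT: "uses_GT n S" and i: "i < m"
  shows "a i = (l i)\<^sup>2" "b i = 1 - l i" "c i = (l i)\<^sup>2"
proof -
  have "mW S * mW S = mU S * mat_diag n (\<lambda>i. case_nat 1 l i * case_nat 1 l i) * transpose_mat (mU S)"
    unfolding W by (subst conj_mult[OF U]) simp_all
  then show "a i = (l i)\<^sup>2" "c i = (l i)\<^sup>2"
    using conj_eqD[of "case_nat 1 a" "\<lambda>i. case_nat 1 l i * case_nat 1 l i" i]
      conj_eqD[of "case_nat 1 c" "\<lambda>i. case_nat 1 l i * case_nat 1 l i" i]
      i A C GT by (simp_all add: uses_GT_def power2_eq_square)
  have "mB S = mU S * mat_diag n (\<lambda>i. 1 - case_nat 1 l i) * transpose_mat (mU S)"
    using GT unfolding uses_GT_def W by (simp add: one_minus_conj[OF U] one_minus_mat_diag)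
  then have "mB S * mB S = mU S * mat_diag n (\<lambda>i. (1 - case_nat 1 l i) * (1 - case_nat 1 l i))
      * transpose_mat (mU S)"
    by (simp add: conj_mult[OF U])
  then have "b i * b i = (1 - l i) * (1 - l i)"
    using conj_eqD[of "case_nat 0 (\<lambda>i. b i * b i)"
        "\<lambda>i. (1 - case_nat 1 l i) * (1 - case_nat 1 l i)" i] i
    unfolding B by simp
  moreover have "0 \<le> 1 - l i"
    using eigenvalue_bounds(2)[OF i] eigenvalue_bounds(4) by simp
  ultimately show "b i = 1 - l i"
    using b_pos[OF i] by (auto simp: square_eq_iff)
qed

lemma M_mat_eq:
  "M_mat d S = diag_blocks (m * d) (\<lambda>i. c (i div d) - (b (i div d))\<^sup>2) (\<lambda>i. - b (i div d))
     (\<lambda>i. b (i div d)) (\<lambda>_. 1)"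
proof -
  have "mat_diag N f - mat_diag N g = mat_diag N (\<lambda>i. f i - g i)"
    "- mat_diag N f = mat_diag N (\<lambda>i. - f i)" for N and f g :: "nat \<Rightarrow> real"
    by (auto simp: mat_diag_def)
  moreover have "dim_row (mat_diag N f) = N" for N and f :: "nat \<Rightarrow> real"
    by (simp add: mat_diag_def)
  ultimately show ?thesis
    by (simp add: M_mat_def Let_def Lam bold_mat_diag diag_blocks_def power2_eq_square)
qed

lemma spectral_norm_Lam_a:
  assumes d: "1 \<le> d" and bd: "\<And>i. i < m \<Longrightarrow> \<bar>a i\<bar> \<le> 1"
  shows "0 \<le> spectral_norm (bold d (Lam_a S))" "spectral_norm (bold d (Lam_a S)) \<le> 1"
    and "i < m \<Longrightarrow> \<bar>a i\<bar> \<le> spectral_norm (bold d (Lam_a S))"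
proof -
  have *: "\<bar>a i\<bar> \<le> spectral_norm (bold d (Lam_a S))" if "i < m" for i
  proof -
    \<comment> \<open>Position \<open>i * d\<close> is the first of the \<open>d\<close> copies of
      entry \<open>i\<close>.\<close>
    have "i * d < m * d" "i * d div d = i"
      using that d by auto
    then show ?thesis
      using abs_le_spectral_norm_mat_diag[of "i * d" "m * d" "\<lambda>i. a (i div d)"]
      by (simp add: Lam bold_mat_diag)
  qed
  show "i < m \<Longrightarrow> \<bar>a i\<bar> \<le> spectral_norm (bold d (Lam_a S))"
    by (rule *)
  show "0 \<le> spectral_norm (bold d (Lam_a S))"
    using *[OF m(2)] by linarith
  show "spectral_norm (bold d (Lam_a S)) \<le> 1"
    using bd by (auto simp: Lam bold_mat_diag less_mult_imp_div_less intro!: spectral_norm_mat_diag_le)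
qed

lemma spectral_norm_inv_Lam_b:
  assumes d: "1 \<le> d" and k: "0 < k" and bd: "\<And>i. i < m \<Longrightarrow> k \<le> b i"
  shows "0 \<le> spectral_norm (inv_mat (bold d (Lam_b S)))"
    and "spectral_norm (inv_mat (bold d (Lam_b S))) \<le> 1 / k"
proof -
  have eq: "inv_mat (bold d (Lam_b S)) = mat_diag (m * d) (\<lambda>i. inverse (b (i div d)))"
    unfolding Lam bold_mat_diag using b_pos
    by (intro inv_mat_mat_diag) (metis less_irrefl less_mult_imp_div_less)
  have "0 < m * d"
    using m d by simp
  from abs_le_spectral_norm_mat_diag[OF this]
  show "0 \<le> spectral_norm (inv_mat (bold d (Lam_b S)))"
    unfolding eq by (rule order_trans[OF abs_ge_zero])
  have "\<bar>inverse (b i)\<bar> \<le> 1 / k" if "i < m" for i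
    using bd[OF that] k b_pos[OF that] by (simp add: field_simps)
  then show "spectral_norm (inv_mat (bold d (Lam_b S))) \<le> 1 / k"
    unfolding eq using k by (intro spectral_norm_mat_diag_le) (auto simp: less_mult_imp_div_less)
qed

end

section \<open>Explicit factorizations\<close>

text \<open>The lower bounds by 1 and the final inequality, which says
  \<open>rho \<le> spectral_norm G\<close>, are what the lower bound on \<open>delta_yz\<close>
  rests on. The bound \<open>K\<close> on the condition number and the gap
  \<open>(1 - rho) / 2\<close> control the upper bounds.\<close>

definition good_factorization :: "real \<Rightarrow> real \<Rightarrow> real mat \<Rightarrow> real mat \<Rightarrow> real mat \<Rightarrow> bool" where
  "good_factorization K rho M P G \<longleftrightarrow> is_factorization M P G \<and>
     1 \<le> spectral_norm P \<and> 1 \<le> spectral_norm (inv_mat P) \<and>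
     spectral_norm P * spectral_norm (inv_mat P) \<le> K \<and>
     (1 - rho) / 2 \<le> 1 - spectral_norm G \<and> 1 - spectral_norm G \<le> 1 - rho"

text \<open>The 2x2 matrices \<open>p i\<close>, \<open>q i\<close>, \<open>g i\<close> are the blocks of \<open>O\<close>, \<open>O\<^sup>-\<^sup>1\<close> and \<open>\<Gamma>\<close>
  belonging to the \<open>i\<close>-th diagonal position.\<close>

lemma good_factorization_diag_blocks:
  fixes M11 M12 M21 M22 p11 p12 p21 p22 q11 q12 q21 q22 g11 g12 g21 g22 :: "nat \<Rightarrow> real"
  assumes N: "0 < N"
    and inv: "\<And>i. i < N \<Longrightarrow> p11 i * q11 i + p12 i * q21 i = 1 \<and> p11 i * q12 i + p12 i * q22 i = 0 \<and>
      p21 i * q11 i + p22 i * q21 i = 0 \<and> p21 i * q12 i + p22 i * q22 i = 1"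
    and eq: "\<And>i. i < N \<Longrightarrow>
      M11 i * p11 i + M12 i * p21 i = p11 i * g11 i + p12 i * g21 i \<and>
      M11 i * p12 i + M12 i * p22 i = p11 i * g12 i + p12 i * g22 i \<and>
      M21 i * p11 i + M22 i * p21 i = p21 i * g11 i + p22 i * g21 i \<and>
      M21 i * p12 i + M22 i * p22 i = p21 i * g12 i + p22 i * g22 i"
    and p: "\<And>i. i < N \<Longrightarrow> (p11 i)\<^sup>2 + (p12 i)\<^sup>2 + (p21 i)\<^sup>2 + (p22 i)\<^sup>2 \<le> K1"
    and q: "\<And>i. i < N \<Longrightarrow> (q11 i)\<^sup>2 + (q12 i)\<^sup>2 + (q21 i)\<^sup>2 + (q22 i)\<^sup>2 \<le> K2"
    and p1: "1 \<le> p11 0" and q1: "1 \<le> q11 0"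
    and K: "sqrt K1 * sqrt K2 \<le> K"
    and g: "\<And>i x y. i < N \<Longrightarrow> (g11 i * x + g12 i * y)\<^sup>2 + (g21 i * x + g22 i * y)\<^sup>2
      \<le> ((1 + rho) / 2)\<^sup>2 * (x\<^sup>2 + y\<^sup>2)"
    and g1: "\<exists>i<N. g11 i = rho" and rho: "0 < rho" "rho < 1"
  shows "good_factorization K rho (diag_blocks N M11 M12 M21 M22)
    (diag_blocks N p11 p12 p21 p22) (diag_blocks N g11 g12 g21 g22)"
proof -
  let ?M = "diag_blocks N M11 M12 M21 M22" and ?P = "diag_blocks N p11 p12 p21 p22"
  let ?Q = "diag_blocks N q11 q12 q21 q22" and ?G = "diag_blocks N g11 g12 g21 g22"
  have PQ: "?P * ?Q = 1\<^sub>m (2 * N)"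
    unfolding diag_blocks_mult diag_blocks_one[symmetric] using inv by (intro diag_blocks_cong) auto
  have QP: "?Q * ?P = 1\<^sub>m (2 * N)"
    by (rule mat_mult_left_right_inverse[OF diag_blocks_carrier diag_blocks_carrier PQ])
  have inv_P: "inv_mat ?P = ?Q"
    using PQ by (intro inv_mat_eqI[of _ "2 * N"]) auto
  \<comment> \<open>The intertwining relation is equivalent to the factorization once
    \<open>?P\<close> is invertible, and it needs only products of two blocks.\<close>
  have "?M * ?P = ?P * ?G"
    unfolding diag_blocks_mult using eq by (intro diag_blocks_cong) auto
  then have "?P * ?G * ?Q = ?M * ?P * ?Q" by simp
  also have "\<dots> = ?M * (?P * ?Q)"
    by (intro assoc_mult_mat[of _ "2 * N" "2 * N" _ "2 * N" _ "2 * N"]) auto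
  also have "\<dots> = ?M"
    by (simp add: PQ)
  finally have M: "?M = ?P * ?G * inv_mat ?P"
    by (simp add: inv_P)
  have norm_G: "spectral_norm ?G \<le> (1 + rho) / 2"
    using g rho by (intro spectral_norm_diag_blocks_le) auto
  have K12: "0 \<le> K1" "0 \<le> K2"
    using p[OF N] q[OF N] by (auto intro: order_trans[rotated] add_nonneg_nonneg)
  have norm_P: "spectral_norm ?P \<le> sqrt K1" and norm_Q: "spectral_norm ?Q \<le> sqrt K2"
    using p q K12 by (auto intro!: spectral_norm_diag_blocks_le frobenius_bound_le)
  have P1: "1 \<le> spectral_norm ?P" and Q1: "1 \<le> spectral_norm ?Q"
    using abs_le_spectral_norm_diag_blocks[OF N, of p11 p12 p21 p22]
      abs_le_spectral_norm_diag_blocks[OF N, of q11 q12 q21 q22] p1 q1 by linarith+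
  have "spectral_norm ?P * spectral_norm ?Q \<le> sqrt K1 * sqrt K2"
    using norm_P norm_Q P1 Q1 K12 by (intro mult_mono) auto
  moreover have "rho \<le> spectral_norm ?G"
    using g1 abs_le_spectral_norm_diag_blocks[of _ N g11 g12 g21 g22] rho by fastforce
  moreover have "is_factorization ?M ?P ?G"
    using M norm_G rho PQ QP
    by (auto simp: is_factorization_def invertible_mat_def inverts_mat_def)
  ultimately show ?thesis
    using K P1 Q1 norm_G by (simp add: good_factorization_def inv_P field_simps)
qed

section \<open>The factorizations for GT and ED\<close>

context mixing_spectra
begin

lemma div_lt: "i < m * d \<Longrightarrow> i div d < m"
  by (rule less_mult_imp_div_less)

lemma rho_bounds: "0 < rho" "rho < 1"
  using rho_ge r eigenvalue_bounds(4) by auto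

lemma rho_attained:
  assumes "1 \<le> d"
  shows "\<exists>i<m * d. l (i div d) = rho"
proof -
  obtain i where i: "i < m" "l i = rho"
    using eigenvalue_bounds(3) by blast
  then have "i * d < m * d" "l (i * d div d) = rho"
    using assms by auto
  then show ?thesis by blast
qed

text \<open>With eigenvalue \<open>t\<close>, the block has trace \<open>2 * t\<close>, determinant
  \<open>t\<^sup>2\<close> and eigenvector \<open>(1, -1)\<close>. The second basis vector
  \<open>(0, 1/2)\<close> carries the factor 1/2 that shrinks the off-diagonal entry to
  \<open>- (1 - t) / 2\<close>. \<open>K1\<close> and \<open>K2\<close> are the squared Frobenius
  norms \<open>1 + 1 + 1/4\<close> and \<open>1 + 4 + 4\<close> of the basis block and its inverse;
  the resulting 9/2 is at most \<open>5 / r\<close> because \<open>r < 1\<close>.\<close>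

lemma GT_good_factorization:
  assumes GT: "uses_GT n S" and d: "1 \<le> d"
  shows "\<exists>P G. good_factorization (5 / r) rho (M_mat d S) P G"
proof -
  define t where "t i = l (i div d)" for i
  have t: "0 < t i" "t i \<le> rho" if "i < m * d" for i
    using eigenvalue_bounds(1,2)[OF div_lt[OF that]] r by (auto simp: t_def)
  have "M_mat d S = diag_blocks (m * d) (\<lambda>i. (t i)\<^sup>2 - (1 - t i)\<^sup>2) (\<lambda>i. - (1 - t i))
      (\<lambda>i. 1 - t i) (\<lambda>_. 1)"
    unfolding M_mat_eq by (intro diag_blocks_cong) (simp add: GT_spectra[OF GT] div_lt t_def)
  moreover have "good_factorization (5 / r) rho \<dots>
      (diag_blocks (m * d) (\<lambda>_. 1) (\<lambda>_. 0) (\<lambda>_. - 1) (\<lambda>_. 1 / 2))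
      (diag_blocks (m * d) t (\<lambda>i. - (1 - t i) / 2) (\<lambda>_. 0) t)"
  proof (rule good_factorization_diag_blocks[where ?K1.0 = "(3 / 2)\<^sup>2" and ?K2.0 = "3\<^sup>2" and
        ?q11.0 = "\<lambda>_. 1" and ?q12.0 = "\<lambda>_. 0" and ?q21.0 = "\<lambda>_. 2" and ?q22.0 = "\<lambda>_. 2"])
    show "sqrt ((3 / 2)\<^sup>2) * sqrt (3\<^sup>2) \<le> 5 / r"
      using rho_ge rho_bounds r unfolding real_sqrt_abs by (simp add: field_simps)
    show "\<exists>i<m * d. t i = rho"
      unfolding t_def by (rule rho_attained[OF d])
    fix i x y assume i: "i < m * d"
    \<comment> \<open>This identity certifies that the upper triangular block has norm at most
      \<open>(1 + t i) / 2\<close>: the defect is visibly nonnegative for \<open>t i\<close> in the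
      unit interval.\<close>
    have "((1 + t i) / 2)\<^sup>2 * (x\<^sup>2 + y\<^sup>2) - ((t i * x + - (1 - t i) / 2 * y)\<^sup>2 + (0 * x + t i * y)\<^sup>2)
        = t i * (1 - t i) * ((x + y)\<^sup>2 + x\<^sup>2 + y\<^sup>2) / 2 + ((1 - t i) / 2 * x)\<^sup>2"
      by (simp add: power2_eq_square field_simps)
    moreover have "0 \<le> t i * (1 - t i) * ((x + y)\<^sup>2 + x\<^sup>2 + y\<^sup>2) / 2 + ((1 - t i) / 2 * x)\<^sup>2"
      using t[OF i] rho_bounds by (intro add_nonneg_nonneg divide_nonneg_pos mult_nonneg_nonneg) auto
    moreover have "((1 + t i) / 2)\<^sup>2 * (x\<^sup>2 + y\<^sup>2) \<le> ((1 + rho) / 2)\<^sup>2 * (x\<^sup>2 + y\<^sup>2)"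
      using t[OF i] by (intro mult_right_mono power_mono) auto
    ultimately show "(t i * x + - (1 - t i) / 2 * y)\<^sup>2 + (0 * x + t i * y)\<^sup>2
        \<le> ((1 + rho) / 2)\<^sup>2 * (x\<^sup>2 + y\<^sup>2)"
      by linarith
  qed (use m d rho_bounds in \<open>auto simp: power2_eq_square field_simps\<close>)
  ultimately show ?thesis by auto
qed

text \<open>Keeping \<open>(1, 0)\<close> as first basis vector, the second one,
  \<open>(- s / q, 1 / q)\<close>, is forced by requiring the first column of the new block to be
  \<open>(t, q * s)\<close>. Since \<open>t\<^sup>2 + q\<^sup>2 * s\<^sup>2 = t\<close>, the new
  block is \<open>q\<close> times a rotation. The squared Frobenius norms are \<open>2 / t\<close>,
  at most \<open>2 / r\<close>, and 2; their roots multiply to \<open>2 / sqrt r\<close>, which is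
  below \<open>5 / r\<close>.\<close>

lemma ED_good_factorization:
  assumes ED: "uses_ED n S" and d: "1 \<le> d"
  shows "\<exists>P G. good_factorization (5 / r) rho (M_mat d S) P G"
proof -
  define t where "t i = l (i div d)" for i
  define s where "s i = sqrt (1 - t i)" for i
  define q where "q i = sqrt (t i)" for i
  have t: "r \<le> t i" "0 < t i" "t i \<le> rho" if "i < m * d" for i
    using eigenvalue_bounds(1,2)[OF div_lt[OF that]] r by (auto simp: t_def)
  have q0: "0 < q i" if "i < m * d" for i
    using t[OF that] by (simp add: q_def)
  have q: "(q i)\<^sup>2 = t i" and s: "(s i)\<^sup>2 = 1 - t i" if "i < m * d" for i
    using t[OF that] rho_bounds by (simp_all add: q_def s_def)
  have "M_mat d S = diag_blocks (m * d) (\<lambda>i. t i - (s i)\<^sup>2) (\<lambda>i. - s i) s (\<lambda>_. 1)"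
    unfolding M_mat_eq
    by (intro diag_blocks_cong) (simp add: ED_spectra[OF ED] div_lt t_def s_def)
  moreover have "good_factorization (5 / r) rho \<dots>
      (diag_blocks (m * d) (\<lambda>_. 1) (\<lambda>i. - s i / q i) (\<lambda>_. 0) (\<lambda>i. 1 / q i))
      (diag_blocks (m * d) t (\<lambda>i. - q i * s i) (\<lambda>i. q i * s i) t)"
  proof (rule good_factorization_diag_blocks[where ?K1.0 = "2 / r" and ?K2.0 = "2" and
        ?q11.0 = "\<lambda>_. 1" and ?q12.0 = s and ?q21.0 = "\<lambda>_. 0" and ?q22.0 = q])
    have "sqrt (2 / r) * sqrt 2 = sqrt (4 / r)"
      by (simp add: real_sqrt_mult[symmetric])
    also have "\<dots> \<le> sqrt ((5 / r)\<^sup>2)"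
      using r rho_ge rho_bounds by (intro real_sqrt_le_mono) (simp add: power2_eq_square field_simps)
    also have "\<dots> = 5 / r"
      using r by (simp add: real_sqrt_abs)
    finally show "sqrt (2 / r) * sqrt 2 \<le> 5 / r" .
    show "\<exists>i<m * d. t i = rho"
      unfolding t_def by (rule rho_attained[OF d])
    fix i assume i: "i < m * d"
    note i0 = q0[OF i] and iq = q[OF i] and si = s[OF i]
    show "1 * 1 + - s i / q i * 0 = 1 \<and> 1 * s i + - s i / q i * q i = 0 \<and>
        0 * 1 + 1 / q i * 0 = 0 \<and> 0 * s i + 1 / q i * q i = 1"
      using i0 by simp
    \<comment> \<open>Multiplying by \<open>q i\<close> clears the denominators; both sides then
      agree by \<open>q\<^sup>2 = t\<close> and \<open>s\<^sup>2 = 1 - t\<close>.\<close>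
    have "(t i - (s i)\<^sup>2) * (- s i / q i) + - s i * (1 / q i) = 1 * (- q i * s i) + - s i / q i * t i"
    proof -
      have "((t i - (s i)\<^sup>2) * (- s i / q i) + - s i * (1 / q i)) * q i
          = - s i * (t i - (s i)\<^sup>2 + 1)"
        using i0 by (simp add: field_simps)
      also have "\<dots> = - s i * ((q i)\<^sup>2 + t i)"
        unfolding iq si by simp
      also have "\<dots> = (1 * (- q i * s i) + - s i / q i * t i) * q i"
        using i0 by (simp add: field_simps power2_eq_square)
      finally show ?thesis using i0 by simp
    qed
    moreover have "s i * (- s i / q i) + 1 * (1 / q i) = 0 * (- q i * s i) + 1 / q i * t i"
    proof -
      have "s i * (- s i / q i) + 1 * (1 / q i) = (1 - (s i)\<^sup>2) / q i"
        by (simp add: power2_eq_square diff_divide_distrib)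
      then show ?thesis by (simp add: si)
    qed
    ultimately show "(t i - (s i)\<^sup>2) * 1 + - s i * 0 = 1 * t i + - s i / q i * (q i * s i) \<and>
        (t i - (s i)\<^sup>2) * (- s i / q i) + - s i * (1 / q i) = 1 * (- q i * s i) + - s i / q i * t i \<and>
        s i * 1 + 1 * 0 = 0 * t i + 1 / q i * (q i * s i) \<and>
        s i * (- s i / q i) + 1 * (1 / q i) = 0 * (- q i * s i) + 1 / q i * t i"
      using i0 by (simp add: power2_eq_square)
    have "1\<^sup>2 + (- s i / q i)\<^sup>2 + 0\<^sup>2 + (1 / q i)\<^sup>2 = 2 / t i"
      using t[OF i] by (simp add: power_divide iq si field_simps)
    also have "\<dots> \<le> 2 / r"
      using t[OF i] r by (intro divide_left_mono) auto
    finally show "1\<^sup>2 + (- s i / q i)\<^sup>2 + 0\<^sup>2 + (1 / q i)\<^sup>2 \<le> 2 / r" .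
    show "1\<^sup>2 + (s i)\<^sup>2 + 0\<^sup>2 + (q i)\<^sup>2 \<le> 2"
      by (simp add: iq si)
    fix x y
    have "(t i * x + - q i * s i * y)\<^sup>2 + (q i * s i * x + t i * y)\<^sup>2
        = ((t i)\<^sup>2 + (q i)\<^sup>2 * (s i)\<^sup>2) * (x\<^sup>2 + y\<^sup>2)"
      by (simp add: power2_eq_square algebra_simps)
    also have "\<dots> = t i * (x\<^sup>2 + y\<^sup>2)"
      unfolding iq si by (simp add: power2_eq_square algebra_simps)
    also have "\<dots> \<le> ((1 + rho) / 2)\<^sup>2 * (x\<^sup>2 + y\<^sup>2)"
    proof (rule mult_right_mono)
      \<comment> \<open>The arithmetic-geometric mean inequality, that is
        \<open>sqrt rho \<le> (1 + rho) / 2\<close>, brings the rotation factor under the same bound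
        as for GT.\<close>
      have "((1 + rho) / 2)\<^sup>2 - rho = ((1 - rho) / 2)\<^sup>2"
        by (simp add: power2_eq_square field_simps)
      then show "t i \<le> ((1 + rho) / 2)\<^sup>2"
        using t[OF i] zero_le_power2[of "(1 - rho) / 2"] by linarith
    qed simp
    finally show "(t i * x + - q i * s i * y)\<^sup>2 + (q i * s i * x + t i * y)\<^sup>2
        \<le> ((1 + rho) / 2)\<^sup>2 * (x\<^sup>2 + y\<^sup>2)" .
  qed (use m d rho_bounds in auto)
  ultimately show ?thesis by auto
qed

section \<open>Norms of \<open>Lam_a\<close> and of the inverse of \<open>Lam_b\<close> for ED and
  GT\<close>

lemma ED_norms:
  assumes ED: "uses_ED n S" and d: "1 \<le> d"
  shows "r \<le> spectral_norm (bold d (Lam_a S))" "spectral_norm (bold d (Lam_a S)) \<le> 1"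
    "0 \<le> spectral_norm (inv_mat (bold d (Lam_b S)))"
    "spectral_norm (inv_mat (bold d (Lam_b S))) \<le> 1 / sqrt (1 - rho)"
proof -
  have a: "r \<le> a i" "\<bar>a i\<bar> \<le> 1" if "i < m" for i
    using ED_spectra(1)[OF ED that] eigenvalue_bounds(1,2)[OF that] rho_bounds r by auto
  show "spectral_norm (bold d (Lam_a S)) \<le> 1"
    using spectral_norm_Lam_a[OF d a(2)] by blast
  show "r \<le> spectral_norm (bold d (Lam_a S))"
    using spectral_norm_Lam_a(3)[OF d a(2) m(2)] a(1)[OF m(2)] by linarith
  have b: "sqrt (1 - rho) \<le> b i" if "i < m" for i
    using ED_spectra(2)[OF ED that] eigenvalue_bounds(2)[OF that] by simp
  have "0 < sqrt (1 - rho)"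
    using rho_bounds by simp
  from spectral_norm_inv_Lam_b[OF d this b]
  show "0 \<le> spectral_norm (inv_mat (bold d (Lam_b S)))"
    "spectral_norm (inv_mat (bold d (Lam_b S))) \<le> 1 / sqrt (1 - rho)" by blast+
qed

lemma GT_norms:
  assumes GT: "uses_GT n S" and d: "1 \<le> d"
  shows "0 \<le> spectral_norm (bold d (Lam_a S))" "spectral_norm (bold d (Lam_a S)) \<le> 1"
    "0 \<le> spectral_norm (inv_mat (bold d (Lam_b S)))"
    "spectral_norm (inv_mat (bold d (Lam_b S))) \<le> 1 / (1 - rho)"
proof -
  have a: "\<bar>a i\<bar> \<le> 1" if "i < m" for i
    using GT_spectra(1)[OF GT that] eigenvalue_bounds(1,2)[OF that] rho_bounds r
    by (simp add: power_le_one)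
  show "spectral_norm (bold d (Lam_a S)) \<le> 1" "0 \<le> spectral_norm (bold d (Lam_a S))"
    using spectral_norm_Lam_a[OF d a] by blast+
  have b: "1 - rho \<le> b i" if "i < m" for i
    using GT_spectra(2)[OF GT that] eigenvalue_bounds(2)[OF that] by simp
  have "0 < 1 - rho"
    using rho_bounds by simp
  from spectral_norm_inv_Lam_b[OF d this b]
  show "0 \<le> spectral_norm (inv_mat (bold d (Lam_b S)))"
    "spectral_norm (inv_mat (bold d (Lam_b S))) \<le> 1 / (1 - rho)" by blast+
qed

end

section \<open>Orders of the six quantities\<close>

text \<open>\<open>t\<close> stands for the spectral gap \<open>1 - rho\<close>, and the assumptions
  are the numerical content of \<open>good_factorization\<close>.\<close>

context
  fixes K t :: real and P G :: "real mat"
  assumes t: "0 < t" "t < 1"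
    and P: "1 \<le> spectral_norm P" "1 \<le> spectral_norm (inv_mat P)"
      "spectral_norm P * spectral_norm (inv_mat P) \<le> K"
    and G: "t / 2 \<le> 1 - spectral_norm G" "1 - spectral_norm G \<le> t"
begin

abbreviation "cond \<equiv> spectral_norm P * spectral_norm (inv_mat P)"

lemma cond_ge: "1 \<le> cond"
  using mult_mono[OF P(1,2)] P by simp

lemma K_ge: "1 \<le> K"
  using cond_ge P by simp

lemma div_gap_le:
  assumes "0 \<le> x" "x \<le> y"
  shows "x / (1 - spectral_norm G) \<le> 2 * y / t"
proof -
  have "x / (1 - spectral_norm G) \<le> y / (t / 2)"
    using assms t G by (intro frac_le) auto
  then show ?thesis by (simp add: mult.commute)
qed

lemma K_powers: "K\<^sup>2 \<le> K ^ 4" "K \<le> K ^ 4"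
  using K_ge power_increasing[of 2 4 K] power_increasing[of 1 4 K] by auto

lemma delta_yz_eq:
  "delta_yz d S P G = (cond\<^sup>2 / (1 - spectral_norm G))\<^sup>2 * (spectral_norm (bold d (Lam_a S)))\<^sup>2"
  by (simp add: delta_yz_def power_mult_distrib)

lemma delta_yz_le:
  assumes a: "0 \<le> spectral_norm (bold d (Lam_a S))" "spectral_norm (bold d (Lam_a S)) \<le> 1"
  shows "delta_yz d S P G \<le> 4 * K ^ 4 / t\<^sup>2"
proof -
  have "cond\<^sup>2 \<le> K\<^sup>2"
    using cond_ge P by (intro power_mono) auto
  from div_gap_le[OF _ this] have "cond\<^sup>2 / (1 - spectral_norm G) \<le> 2 * K\<^sup>2 / t"
    by simp
  then have "(cond\<^sup>2 / (1 - spectral_norm G))\<^sup>2 \<le> (2 * K\<^sup>2 / t)\<^sup>2"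
    using t G by (intro power_mono) auto
  moreover have "(spectral_norm (bold d (Lam_a S)))\<^sup>2 \<le> 1"
    using a by (simp add: power_le_one)
  ultimately have "delta_yz d S P G \<le> (2 * K\<^sup>2 / t)\<^sup>2 * 1"
    unfolding delta_yz_eq by (intro mult_mono) auto
  then show ?thesis by (simp add: power_divide power_mult_distrib power_mult[symmetric])
qed

text \<open>The condition number is at least 1 and the gap of \<open>G\<close> is at most
  \<open>t\<close>, so no choice of constants in the factorization can push the quantity below this
  order.\<close>

lemma delta_yz_ge:
  assumes a: "0 \<le> r" "r \<le> spectral_norm (bold d (Lam_a S))"
  shows "r\<^sup>2 / t\<^sup>2 \<le> delta_yz d S P G"
proof -
  have "1 / t \<le> cond\<^sup>2 / (1 - spectral_norm G)"
    using cond_ge t G by (intro frac_le) auto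
  then have "(1 / t)\<^sup>2 \<le> (cond\<^sup>2 / (1 - spectral_norm G))\<^sup>2"
    using t by (intro power_mono) auto
  moreover have "r\<^sup>2 \<le> (spectral_norm (bold d (Lam_a S)))\<^sup>2"
    using a by (intro power_mono) auto
  ultimately have "(1 / t)\<^sup>2 * r\<^sup>2 \<le> delta_yz d S P G"
    unfolding delta_yz_eq by (intro mult_mono) auto
  then show ?thesis by (simp add: power_divide)
qed

lemma delta_x_le:
  assumes a: "0 \<le> spectral_norm (bold d (Lam_a S))" "spectral_norm (bold d (Lam_a S)) \<le> 1"
  shows "delta_x d S P G \<le> 4 * K ^ 4 / t\<^sup>2"
proof -
  have "cond / (1 - spectral_norm G) * spectral_norm (bold d (Lam_a S)) \<le> 2 * K / t * 1"
    using a P cond_ge t K_ge by (intro mult_mono div_gap_le) auto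
  then have "delta_x d S P G \<le> (2 * K / t * 1)\<^sup>2"
    unfolding delta_x_def using a cond_ge t G by (intro power_mono mult_nonneg_nonneg) auto
  also have "\<dots> = 4 * K\<^sup>2 / t\<^sup>2"
    by (simp add: power_divide power_mult_distrib)
  \<comment> \<open>\<open>K\<^sup>2\<close> is weakened to \<open>K ^ 4\<close>, the power needed
    for \<open>delta_yz\<close>, so that one constant serves all six quantities.\<close>
  also have "\<dots> \<le> 4 * K ^ 4 / t\<^sup>2"
    using K_powers by (intro divide_right_mono) auto
  finally show ?thesis .
qed

text \<open>The base is at most \<open>2 * K * t powr (- 3 / 2)\<close>, where the extra half power
  comes from the ED bound on the inverse of \<open>Lam_b\<close>; the exponent 4/3 turns this into
  order \<open>t powr (- 2)\<close>.\<close>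

lemma delta_hat_yz_le:
  assumes b: "0 \<le> spectral_norm (inv_mat (bold d (Lam_b S)))"
    "spectral_norm (inv_mat (bold d (Lam_b S))) \<le> 1 / sqrt t"
  shows "delta_hat_yz d S P G \<le> 4 * K ^ 4 / t\<^sup>2"
proof -
  let ?h = "spectral_norm (inv_mat (bold d (Lam_b S)))"
  have "cond * ?h \<le> K * (1 / sqrt t)"
    using P b cond_ge K_ge by (intro mult_mono) auto
  then have "cond * ?h / (1 - spectral_norm G) \<le> 2 * (K * (1 / sqrt t)) / t"
    using b cond_ge by (intro div_gap_le) auto
  also have "\<dots> = 2 * K * t powr (- 3 / 2)"
  proof -
    have "t powr (3 / 2) = t powr (1 + 1 / 2)" by simp
    also have "\<dots> = t * sqrt t"
      using t unfolding powr_add by (simp add: powr_half_sqrt)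
    finally show ?thesis
      using t by (simp add: powr_minus_divide)
  qed
  finally have "delta_hat_yz d S P G \<le> (2 * K * t powr (- 3 / 2)) powr (4 / 3)"
    unfolding delta_hat_yz_def using b cond_ge t G
    by (intro powr_mono2 divide_nonneg_nonneg mult_nonneg_nonneg[of cond]) auto
  also have "\<dots> = (2 * K) powr (4 / 3) * t powr (- 2)"
    using t by (simp add: powr_mult powr_powr)
  also have "t powr (- 2) = 1 / t\<^sup>2"
    using t by (simp add: powr_minus_divide)
  also have "(2 * K) powr (4 / 3) * (1 / t\<^sup>2) \<le> (2 * K) powr 2 * (1 / t\<^sup>2)"
    using K_ge by (intro mult_right_mono powr_mono) auto
  also have "\<dots> = 4 * K\<^sup>2 / t\<^sup>2"
    using K_ge by (simp add: power_mult_distrib)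
  also have "\<dots> \<le> 4 * K ^ 4 / t\<^sup>2"
    using K_powers by (intro divide_right_mono) auto
  finally show ?thesis .
qed

text \<open>With the GT bound \<open>1 / t\<close> for the inverse of \<open>Lam_b\<close>, the
  first summand is of order \<open>t powr (- 3)\<close> raised to 2/3, the second of order
  \<open>1 / t\<^sup>2\<close> directly. Each is at most \<open>2 * K ^ 4 / t\<^sup>2\<close>, which
  explains the factor 4.\<close>

lemma delta_hat_x_le:
  assumes b: "0 \<le> spectral_norm (inv_mat (bold d (Lam_b S)))"
    "spectral_norm (inv_mat (bold d (Lam_b S))) \<le> 1 / t"
  shows "delta_hat_x d S P G \<le> 4 * K ^ 4 / t\<^sup>2"
proof -
  let ?h = "spectral_norm (inv_mat (bold d (Lam_b S)))"
  have le: "cond * ?h \<le> K * (1 / t)"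
    using P b cond_ge K_ge by (intro mult_mono) auto
  then have "cond * ?h / (1 - spectral_norm G) \<le> 2 * (K * (1 / t)) / t"
    using b cond_ge by (intro div_gap_le) auto
  also have "\<dots> = 2 * K / t\<^sup>2"
    by (simp add: power2_eq_square)
  also have "\<dots> \<le> 2 * K ^ 4 / t\<^sup>2"
    using K_powers by (intro divide_right_mono) auto
  finally have 1: "cond * ?h / (1 - spectral_norm G) \<le> 2 * K ^ 4 / t\<^sup>2" .
  have nonneg: "0 \<le> cond * ?h"
    using cond_ge b by (intro mult_nonneg_nonneg[of cond]) auto
  then have "(cond * ?h)\<^sup>2 \<le> (K * (1 / t))\<^sup>2"
    using le by (intro power_mono) auto
  then have "(cond * ?h)\<^sup>2 / (1 - spectral_norm G) \<le> 2 * (K * (1 / t))\<^sup>2 / t"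
    by (intro div_gap_le) auto
  also have "\<dots> = 2 * K\<^sup>2 * t powr (- 3)"
    using t by (simp add: powr_minus_divide power_divide power3_eq_cube power2_eq_square)
  finally have "((cond * ?h)\<^sup>2 / (1 - spectral_norm G)) powr (2 / 3)
      \<le> (2 * K\<^sup>2 * t powr (- 3)) powr (2 / 3)"
    using t G by (intro powr_mono2) auto
  also have "\<dots> = (2 * K\<^sup>2) powr (2 / 3) * t powr (- 2)"
    using t by (simp add: powr_mult powr_powr)
  also have "t powr (- 2) = 1 / t\<^sup>2"
    using t by (simp add: powr_minus_divide)
  also have "(2 * K\<^sup>2) powr (2 / 3) * (1 / t\<^sup>2) \<le> (2 * K\<^sup>2) powr 1 * (1 / t\<^sup>2)"
    using one_le_power[OF K_ge, of 2] by (intro mult_right_mono powr_mono) auto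
  also have "\<dots> = 2 * K\<^sup>2 / t\<^sup>2"
    by simp
  also have "\<dots> \<le> 2 * K ^ 4 / t\<^sup>2"
    using K_powers by (intro divide_right_mono) auto
  finally show ?thesis
    using 1 unfolding delta_hat_x_def power_mult_distrib[symmetric] by simp
qed

end

text \<open>For \<open>n \<ge> 1\<close> every weight is at most \<open>n ^ 3\<close>, which gives
  the upper bound; the lower bound retains just the term with \<open>dy\<close>.\<close>

lemma transient_complexity_bounds:
  assumes n: "1 \<le> n"
    and le: "\<And>d. d \<in> {dx, dy, dz, hx, hy, hz} \<Longrightarrow> d \<le> C" and C: "0 \<le> C"
    and ge: "c \<le> dy"
  shows "real n ^ 3 * c \<le> transient_complexity n dx dy dz hx hy hz"
    and "transient_complexity n dx dy dz hx hy hz \<le> real n ^ 3 * C"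
proof -
  have "real n ^ 3 * c \<le> real n ^ 3 * dy"
    using ge by (intro mult_left_mono) auto
  also have "\<dots> \<le> transient_complexity n dx dy dz hx hy hz"
    unfolding transient_complexity_def by (intro Max_ge) auto
  finally show "real n ^ 3 * c \<le> transient_complexity n dx dy dz hx hy hz" .
  have "real n ^ k * d \<le> real n ^ 3 * C" if "d \<in> {dx, dy, dz, hx, hy, hz}" "k \<le> 3" for k d
  proof -
    have "real n ^ k * d \<le> real n ^ k * C"
      using le[OF that(1)] by (intro mult_left_mono) auto
    also have "\<dots> \<le> real n ^ 3 * C"
      using n that(2) C by (intro mult_right_mono power_increasing) auto
    finally show ?thesis .
  qed
  from this[of _ 1] this[of _ 2] this[of _ 3]
  show "transient_complexity n dx dy dz hx hy hz \<le> real n ^ 3 * C"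
    unfolding transient_complexity_def by simp
qed

section \<open>Uniform constants for all agent numbers and dimensions\<close>

theorem corollary4:
  fixes rho_min :: real
  assumes "0 < rho_min"
  shows "\<exists>c C :: real. 0 < c \<and> 0 < C \<and>
    (\<forall>(n::nat) (p::nat) (q::nat) X Y Z.
       2 \<le> n \<and> 1 \<le> p \<and> 1 \<le> q \<and>
       (\<forall>S \<in> {X, Y, Z}. mixing_matrix rho_min n (mW S) \<and> spectral_data n S) \<and>
       mW X = mW Y \<and> mW Y = mW Z \<and>
       uses_GT n X \<and> uses_ED n Y \<and> uses_ED n Z \<longrightarrow>
       (\<exists>(fac_O :: real mat \<Rightarrow> real mat) (fac_Gamma :: real mat \<Rightarrow> real mat).
          let rho = mixing_rho (mW X);
              Mx = M_mat p X; My = M_mat q Y; Mz = M_mat q Z;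
              dx = delta_x p X (fac_O Mx) (fac_Gamma Mx);
              dy = delta_yz q Y (fac_O My) (fac_Gamma My);
              dz = delta_yz q Z (fac_O Mz) (fac_Gamma Mz);
              hx = delta_hat_x p X (fac_O Mx) (fac_Gamma Mx);
              hy = delta_hat_yz q Y (fac_O My) (fac_Gamma My);
              hz = delta_hat_yz q Z (fac_O Mz) (fac_Gamma Mz);
              T = transient_complexity n dx dy dz hx hy hz
          in (\<forall>M \<in> {Mx, My, Mz}. is_factorization M (fac_O M) (fac_Gamma M)) \<and>
             (\<forall>d \<in> {dx, dy, dz, hx, hy, hz}. d \<le> C / (1 - rho)\<^sup>2) \<and>
             c * (real n ^ 3 / (1 - rho)\<^sup>2) \<le> T \<and> T \<le> C * (real n ^ 3 / (1 - rho)\<^sup>2)))"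
proof -
  define K where "K = 5 / rho_min"
  show ?thesis
  \<comment> \<open>Both witnesses depend on \<open>rho_min\<close> alone:
    \<open>rho_min\<^sup>2\<close> comes from \<open>delta_yz_ge\<close>, and
    \<open>4 * K ^ 4\<close> is the common upper constant with \<open>K\<close> bounding the
    condition numbers.\<close>
  proof (rule exI[of _ "rho_min\<^sup>2"], rule exI[of _ "4 * K ^ 4"], intro conjI allI impI, goal_cases)
    case 1
    show ?case using assms by simp
  next
    case 2
    show ?case using assms by (simp add: K_def)
  next
    case (3 n p q X Y Z)
    then have dims: "2 \<le> n" "1 \<le> p" "1 \<le> q"
      and S: "\<forall>S \<in> {X, Y, Z}. mixing_matrix rho_min n (mW S) \<and> spectral_data n S"
      and W: "mW X = mW Y" "mW Y = mW Z"
      and methods: "uses_GT n X" "uses_ED n Y" "uses_ED n Z"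
      by blast+
    define rho where "rho = mixing_rho (mW X)"
    have rho_eq: "mixing_rho (mW X) = rho" "mixing_rho (mW Y) = rho" "mixing_rho (mW Z) = rho"
      using W by (simp_all add: rho_def)
    obtain mx lx ax bx cx where "mixing_spectra rho_min n mx X lx ax bx cx"
      using mixing_spectraE[OF assms] S dims by blast
    then interpret X: mixing_spectra rho_min n mx X lx ax bx cx .
    obtain my ly ay "by" cy where "mixing_spectra rho_min n my Y ly ay by cy"
      using mixing_spectraE[OF assms] S dims by blast
    then interpret Y: mixing_spectra rho_min n my Y ly ay "by" cy .
    obtain mz lz az bz cz where "mixing_spectra rho_min n mz Z lz az bz cz"
      using mixing_spectraE[OF assms] S dims by blast
    then interpret Z: mixing_spectra rho_min n mz Z lz az bz cz .
    define Mx My Mz where M_defs: "Mx = M_mat p X" "My = M_mat q Y" "Mz = M_mat q Z"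
    have "\<exists>P G. good_factorization K rho M P G" if "M \<in> {Mx, My, Mz}" for M
      using that X.GT_good_factorization[of p] Y.ED_good_factorization[of q]
        Z.ED_good_factorization[of q] methods dims
      by (auto simp: K_def rho_eq M_defs)
    \<comment> \<open>The factors are chosen as functions of the matrix, so equal matrices, such as
      \<open>My\<close> and \<open>Mz\<close> when their data agree, receive the same
      factorization.\<close>
    then obtain fO fG where good: "\<And>M. M \<in> {Mx, My, Mz} \<Longrightarrow> good_factorization K rho M (fO M) (fG M)"
      by metis
    have t: "0 < 1 - rho" "1 - rho < 1"
      using X.rho_bounds by (simp_all add: rho_eq)
    have fac: "1 \<le> spectral_norm (fO M)" "1 \<le> spectral_norm (inv_mat (fO M))"
      "spectral_norm (fO M) * spectral_norm (inv_mat (fO M)) \<le> K"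
      "(1 - rho) / 2 \<le> 1 - spectral_norm (fG M)" "1 - spectral_norm (fG M) \<le> 1 - rho"
      if "M \<in> {Mx, My, Mz}" for M
      using good[OF that] by (simp_all add: good_factorization_def)
    have inM: "Mx \<in> {Mx, My, Mz}" "My \<in> {Mx, My, Mz}" "Mz \<in> {Mx, My, Mz}"
      by auto
    note nx = X.GT_norms[OF methods(1) dims(2), unfolded rho_eq]
    note ny = Y.ED_norms[OF methods(2) dims(3), unfolded rho_eq]
    note nz = Z.ED_norms[OF methods(3) dims(3), unfolded rho_eq]
    let ?dx = "delta_x p X (fO Mx) (fG Mx)" and ?dy = "delta_yz q Y (fO My) (fG My)"
    let ?dz = "delta_yz q Z (fO Mz) (fG Mz)" and ?hx = "delta_hat_x p X (fO Mx) (fG Mx)"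
    let ?hy = "delta_hat_yz q Y (fO My) (fG My)" and ?hz = "delta_hat_yz q Z (fO Mz) (fG Mz)"
    have a0: "0 \<le> spectral_norm (bold q (Lam_a Y))" "0 \<le> spectral_norm (bold q (Lam_a Z))"
      using ny(1) nz(1) assms by linarith+
    have le: "d \<le> 4 * K ^ 4 / (1 - rho)\<^sup>2" if "d \<in> {?dx, ?dy, ?dz, ?hx, ?hy, ?hz}" for d
      using that delta_x_le[OF t fac[OF inM(1)] nx(1,2)]
        delta_yz_le[OF t fac[OF inM(2)] a0(1) ny(2)] delta_yz_le[OF t fac[OF inM(3)] a0(2) nz(2)]
        delta_hat_x_le[OF t fac[OF inM(1)] nx(3,4)]
        delta_hat_yz_le[OF t fac[OF inM(2)] ny(3,4)] delta_hat_yz_le[OF t fac[OF inM(3)] nz(3,4)]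
      by blast
    have ge: "rho_min\<^sup>2 / (1 - rho)\<^sup>2 \<le> ?dy"
      using delta_yz_ge[OF t fac[OF inM(2)] _ ny(1)] assms by simp
    have n1: "1 \<le> n" and C0: "0 \<le> 4 * K ^ 4 / (1 - rho)\<^sup>2"
      using dims by simp_all
    note T = transient_complexity_bounds[of n ?dx ?dy ?dz ?hx ?hy ?hz, OF n1 le C0 ge]
    have facs: "\<forall>M \<in> {Mx, My, Mz}. is_factorization M (fO M) (fG M)"
      using good by (auto simp: good_factorization_def)
    show ?case
      unfolding Let_def rho_eq M_defs[symmetric]
    proof (rule exI[of _ fO], rule exI[of _ fG], intro conjI)
      show "\<forall>M \<in> {Mx, My, Mz}. is_factorization M (fO M) (fG M)"
        by (rule facs)
      show "\<forall>d \<in> {?dx, ?dy, ?dz, ?hx, ?hy, ?hz}. d \<le> 4 * K ^ 4 / (1 - rho)\<^sup>2"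
        using le by blast
      show "rho_min\<^sup>2 * (real n ^ 3 / (1 - rho)\<^sup>2) \<le> transient_complexity n ?dx ?dy ?dz ?hx ?hy ?hz"
        using T(1) by (simp add: mult.commute)
      show "transient_complexity n ?dx ?dy ?dz ?hx ?hy ?hz \<le> 4 * K ^ 4 * (real n ^ 3 / (1 - rho)\<^sup>2)"
        using T(2) by (simp add: ac_simps)
    qed
  qed
qed

end
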